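(* Let $n>1$ be an integer, let $k_1$ and $k_2$ be even divisors of $n$, and let $S=\mathbb{F}_{2^{k_1}}\cup\mathbb{F}_{2^{k_2}}\subseteq\mathbb{F}_{2^n}$. Then the function $f(x)=x^{-1}+\delta_S(x)$ is a differentially 4-uniform permutation over $\mathbb{F}_{2^n}$.
   Context: The convention $0^{-1}=0$ is used, so $x^{-1}=x^{2^n-2}$ on $\mathbb{F}_{2^n}$. For $S\subseteq\mathbb{F}_{2^n}$, $\delta_S:\mathbb{F}_{2^n}\to\mathbb{F}_2\subseteq\mathbb{F}_{2^n}$ is the characteristic function: $\delta_S(x)=1$ if $x\in S$ and $\delta_S(x)=0$ otherwise. For $f:\mathbb{F}_{2^n}\to\mathbb{F}_{2^n}$, the differential uniformity is $\Delta_f=\max\{N(a,b): a,b\in\mathbb{F}_{2^n}, a\neq 0\}$, where $N(a,b)$ is the number of $x\in\mathbb{F}_{2^n}$ with $f(x+a)+f(x)=b$. $f$ is differentially 4-uniform if $\Delta_f=4$. *)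

theory Defs
  imports "HOL-Library.Indicator_Function" "HOL-Library.Cardinality"
begin

definition is_subfield :: "'a::field set \<Rightarrow> bool" where
  "is_subfield K \<longleftrightarrow>
     0 \<in> K \<and> 1 \<in> K \<and>
     (\<forall>x\<in>K. \<forall>y\<in>K. x + y \<in> K) \<and>
     (\<forall>x\<in>K. \<forall>y\<in>K. x * y \<in> K) \<and>
     (\<forall>x\<in>K. - x \<in> K) \<and>
     (\<forall>x\<in>K. inverse x \<in> K)"

text \<open>
  The derivative of \<open>f\<close> in direction \<open>a\<close> is written with \<open>+\<close>, so the next definitions are meant
  for fields of characteristic 2.
\<close>

definition diff_count :: "('a::{field,finite} \<Rightarrow> 'a) \<Rightarrow> 'a \<Rightarrow> 'a \<Rightarrow> nat" where
  "diff_count f a b = card {x. f (x + a) + f x = b}"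

definition differential_uniformity :: "('a::{field,finite} \<Rightarrow> 'a) \<Rightarrow> nat" where
  "differential_uniformity f = Max {diff_count f a b | a b. a \<noteq> 0}"

definition differentially_uniform :: "nat \<Rightarrow> ('a::{field,finite} \<Rightarrow> 'a) \<Rightarrow> bool" where
  "differentially_uniform d f \<longleftrightarrow> differential_uniformity f = d"

end

theory Submission
  imports Defs "HOL-Computational_Algebra.Polynomial"
begin

text \<open>
  Since \<open>S\<close> is closed under inversion and under \<open>x \<mapsto> x + 1\<close>, \<open>f\<close> permutes \<open>S\<close> and its
  complement. A solution of \<open>f (x + a) + f x = b\<close> solves \<open>inverse (x + a) + inverse x = c\<close> with
  \<open>c = b\<close> if \<open>x\<close> and \<open>x + a\<close> are both in or both outside \<open>S\<close>, and with \<open>c = b + 1\<close> otherwise.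
  The latter equation has at most two solutions unless \<open>c = inverse a\<close>, when the solutions are
  \<open>0\<close>, \<open>a\<close>, \<open>a * w\<close>, \<open>a * (w + 1)\<close> for a primitive cube root of unity \<open>w\<close>. As the \<open>k\<^sub>i\<close> are even,
  \<open>w\<close> lies in both subfields, so these exceptional solutions are distributed over the two
  types in a controlled way. The only delicate case is \<open>b = inverse a\<close> with \<open>a \<in> S\<close>, where all
  four are of the first type and no solution of the second type may exist.
\<close>

section \<open>Arithmetic in characteristic 2\<close>

text \<open>Translation by 1 permutes the field, so comparing the two sums over all elements makes
  \<open>of_nat CARD('a)\<close> vanish.\<close>

lemma char_two_of_card:
  assumes "CARD('a::{field,finite}) = 2 ^ n"
  shows "(2::'a) = 0"
proof -
  have "(\<Sum>x\<in>(UNIV::'a set). x) = (\<Sum>x\<in>(UNIV::'a set). x + 1)"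
    by (rule sum.reindex_bij_witness[of _ "\<lambda>x. x + 1" "\<lambda>x. x - 1"]) auto
  then have "of_nat CARD('a) = (0::'a)"
    by (simp add: sum.distrib)
  then show ?thesis
    using assms by simp
qed

context
  assumes two: "(2::'a::field) = 0"
begin

lemma char_two_add_self: "(x::'a) + x = 0"
  using two by (metis mult_2 mult_zero_left)

lemma char_two_minus: "- (x::'a) = x"
  using char_two_add_self by (metis minus_unique)

lemma char_two_add_eq_0_iff: "(x::'a) + y = 0 \<longleftrightarrow> x = y"
  by (metis char_two_minus add_eq_0_iff)

lemma char_two_frobenius: "((x::'a) + y) ^ (2 ^ k) = x ^ (2 ^ k) + y ^ (2 ^ k)"
proof (induction k)
  case (Suc k)
  have "(u + v) ^ 2 = u ^ 2 + v ^ 2" for u v :: 'a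
    by (simp add: power2_sum two)
  with Suc show ?case
    by (simp add: power_mult mult.commute[of 2])
qed simp

lemma char_two_quadratic_roots:
  fixes a x y :: 'a
  assumes "x ^ 2 + a * x = y ^ 2 + a * y"
  shows "x = y \<or> x = y + a"
proof -
  have "(x - y) * (x + y + a) = 0"
    using assms by algebra
  then show ?thesis
    using char_two_add_eq_0_iff[of x "y + a"] by (auto simp: add.assoc)
qed

end

section \<open>Subfields of finite fields and cube roots of unity\<close>

text \<open>Multiplication by a nonzero \<open>x\<close> in \<open>K\<close> permutes the nonzero
  elements of \<open>K\<close>, and their product can be cancelled.\<close>

lemma subfield_power_card:
  fixes K :: "'a::{field,finite} set"
  assumes "is_subfield K" "x \<in> K"
  shows "x ^ card K = x"
proof (cases "x = 0")
  case True
  then show ?thesis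
    using assms by (auto simp: power_0_left card_eq_0_iff)
next
  case False
  define U where "U = K - {0}"
  have U: "0 \<notin> U" "card K = Suc (card U)"
    using assms card_Suc_Diff1[of K 0] by (auto simp: U_def is_subfield_def)
  have K: "u * v \<in> K" "inverse u \<in> K" if "u \<in> K" "v \<in> K" for u v
    using assms that by (auto simp: is_subfield_def)
  have "(\<Prod>y\<in>U. y) = (\<Prod>y\<in>U. x * y)"
    by (rule prod.reindex_bij_witness[of _ "\<lambda>y. x * y" "\<lambda>y. inverse x * y"])
      (use False assms K in \<open>auto simp: U_def\<close>)
  also have "\<dots> = x ^ card U * (\<Prod>y\<in>U. y)"
    by (simp add: prod.distrib)
  finally have "x ^ card U = 1"
    using U by simp
  then show ?thesis
    using U by simp
qed

text \<open>The elements of \<open>K\<close> already exhaust the roots that the degree of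
  \<open>p\<close> allows. For \<open>card K = 2 ^ k\<close> membership thus becomes a fixed-point
  condition for a Frobenius map.\<close>

lemma subfield_mem_iff:
  fixes K :: "'a::{field,finite} set"
  assumes K: "is_subfield K"
  shows "x \<in> K \<longleftrightarrow> x ^ card K = x"
proof -
  define p :: "'a poly" where "p = monom 1 (card K) - monom 1 1"
  \<comment> \<open>Two elements in \<open>K\<close> give the monomials of \<open>p\<close>
    different degrees, so \<open>p\<close> is nonzero.\<close>
  have "{0, 1} \<subseteq> K"
    using K by (auto simp: is_subfield_def)
  then have "card {0, 1::'a} \<le> card K"
    by (intro card_mono) auto
  then have c: "card K \<ge> 2"
    by simp
  then have "coeff p (card K) = 1"
    by (simp add: p_def)
  then have "p \<noteq> 0"
    by auto
  moreover have "degree p \<le> card K"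
    unfolding p_def by (rule degree_diff_le) (use c in \<open>auto intro: order.trans[OF degree_monom_le]\<close>)
  ultimately have "card {x. poly p x = 0} \<le> card K"
    using card_poly_roots_bound[of p] by simp
  moreover have "{x. poly p x = 0} = {x. x ^ card K = x}"
    by (simp add: p_def poly_monom)
  moreover have "K \<subseteq> {x. x ^ card K = x}"
    using subfield_power_card[OF K] by auto
  ultimately have "K = {x. x ^ card K = x}"
    by (intro card_seteq) auto
  then show ?thesis
    by blast
qed

text \<open>If the multiplicative group has order \<open>3 * m\<close>, some nonzero
  \<open>x\<close> is not a root of X^m - 1; then \<open>x ^ m\<close> is a cube root of unity other
  than 1.\<close>

lemma exists_primitive_cube_root_of_unity:
  assumes "3 dvd CARD('a::{field,finite}) - 1"
  obtains w :: "'a::{field,finite}" where "w ^ 2 + w + 1 = 0"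
proof -
  obtain m where m: "CARD('a) - 1 = 3 * m"
    using assms by (elim dvdE)
  have "card {0, 1::'a} \<le> CARD('a)"
    by (intro card_mono) auto
  then have mpos: "m > 0"
    using m by (intro gr0I) simp
  define p :: "'a poly" where "p = monom 1 m - 1"
  have p: "p \<noteq> 0"
  proof -
    have "coeff p m = 1"
      using mpos by (simp add: p_def)
    then show ?thesis
      by auto
  qed
  have "degree p \<le> m"
    unfolding p_def by (rule degree_diff_le) (auto intro: degree_monom_le)
  with card_poly_roots_bound[OF p] have le: "card {x. poly p x = 0} \<le> m"
    by simp
  have "\<exists>x::'a. x \<noteq> 0 \<and> x ^ m \<noteq> 1"
  proof (rule ccontr)
    assume "\<not> ?thesis"
    then have "UNIV - {0} \<subseteq> {x. poly p x = 0}"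
      by (auto simp: p_def poly_monom)
    then have "card (UNIV - {0::'a}) \<le> card {x. poly p x = 0}"
      by (intro card_mono) auto
    with le m mpos show False
      by (simp add: card_Diff_singleton)
  qed
  then obtain x :: 'a where x: "x \<noteq> 0" "x ^ m \<noteq> 1"
    by blast
  have "x ^ CARD('a) = x"
    by (rule subfield_power_card) (auto simp: is_subfield_def)
  moreover have "CARD('a) = Suc (3 * m)"
    using m mpos by simp
  ultimately have "(x ^ m) ^ 3 = 1"
    using x by (simp add: power_mult mult.commute[of 3])
  then have "(x ^ m - 1) * ((x ^ m) ^ 2 + x ^ m + 1) = 0"
    by (simp add: algebra_simps power2_eq_square power3_eq_cube)
  with x that show ?thesis
    by simp
qed

text \<open>Since \<open>w ^ 4 = w\<close> and an even \<open>k\<close> makes \<open>card K\<close>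
  a power of 4, \<open>w\<close> is fixed by the map that characterizes \<open>K\<close>.\<close>

lemma cube_root_of_unity_mem_subfield:
  fixes K :: "'a::{field,finite} set"
  assumes K: "is_subfield K" "card K = 2 ^ k" "even k"
    and w: "w ^ 2 + w + 1 = 0"
  shows "w \<in> K"
proof -
  have "w ^ 4 - w = w * (w - 1) * (w ^ 2 + w + 1)"
    by (simp add: algebra_simps eval_nat_numeral)
  then have w4: "w ^ 4 = w"
    using w by simp
  have "w ^ (4 ^ m) = w" for m
    by (induction m) (auto simp: power_mult w4)
  moreover obtain m where "k = 2 * m"
    using K by auto
  ultimately have "w ^ card K = w"
    using K by (simp add: power_mult)
  then show ?thesis
    using subfield_mem_iff[OF K(1)] by blast
qed

section \<open>The derivative of inversion\<close>

text \<open>At \<open>x = 0\<close> and \<open>x = a\<close> the convention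
  \<open>inverse 0 = 0\<close> yields the value \<open>inverse a\<close>; excluding it permits
  clearing denominators.\<close>

lemma inverse_derivative_generic:
  fixes a x c :: "'a::field"
  assumes two: "(2::'a) = 0" and a: "a \<noteq> 0"
    and c: "c \<noteq> inverse a" and x: "inverse (x + a) + inverse x = c"
  shows "c \<noteq> 0" "x ^ 2 + a * x = a / c"
proof -
  have x0: "x \<noteq> 0" "x + a \<noteq> 0"
    using c x char_two_add_eq_0_iff[OF two, of x a] by auto
  have "inverse (x + a) + inverse x = (x + (x + a)) / (x * (x + a))"
    using x0 by (simp add: divide_simps)
  also have "x + (x + a) = a"
    using char_two_add_self[OF two, of x] by (simp flip: add.assoc)
  finally have "c = a / (x * (x + a))"
    using x by simp
  moreover have "x ^ 2 + a * x = x * (x + a)"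
    by (simp add: power2_eq_square algebra_simps)
  ultimately show "c \<noteq> 0" "x ^ 2 + a * x = a / c"
    using x0 a by auto
qed

lemma card_inverse_derivative_generic:
  fixes a c :: "'a::{field,finite}"
  assumes "(2::'a) = 0" "a \<noteq> 0" "c \<noteq> inverse a"
  shows "card {x. inverse (x + a) + inverse x = c} \<le> 2"
proof (cases "\<exists>y. inverse (y + a) + inverse y = c")
  case True
  then obtain y where y: "inverse (y + a) + inverse y = c"
    by blast
  have "x ^ 2 + a * x = y ^ 2 + a * y" if "inverse (x + a) + inverse x = c" for x
    using inverse_derivative_generic(2)[OF assms] y that by simp
  then have "{x. inverse (x + a) + inverse x = c} \<subseteq> {y, y + a}"
    using char_two_quadratic_roots[OF assms(1)] by blast
  then have "card {x. inverse (x + a) + inverse x = c} \<le> card {y, y + a}"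
    by (intro card_mono) auto
  also have "\<dots> \<le> 2"
    by (simp add: card_insert_if)
  finally show ?thesis .
qed simp

text \<open>Away from \<open>0\<close> and \<open>a\<close>, clearing denominators leaves
  \<open>x ^ 2 + a * x = a ^ 2\<close>, whose roots are \<open>a * w\<close> and
  \<open>a * w + a\<close>.\<close>

lemma inverse_derivative_special:
  fixes a w x :: "'a::field"
  assumes two: "(2::'a) = 0" and a: "a \<noteq> 0" and w: "w ^ 2 + w + 1 = 0"
    and x: "inverse (x + a) + inverse x = inverse a"
  shows "x \<in> {0, a, a * w, a * (w + 1)}"
proof (cases "x = 0 \<or> x + a = 0")
  case True
  then show ?thesis
    using char_two_add_eq_0_iff[OF two, of x a] by auto
next
  case False
  then have "(x + (x + a)) * a = x * (x + a)"
    using x a by (simp add: divide_simps)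
  also have "x + (x + a) = a"
    using char_two_add_self[OF two, of x] by (simp flip: add.assoc)
  finally have "x ^ 2 + a * x = a ^ 2"
    by (simp add: power2_eq_square algebra_simps)
  moreover have "w ^ 2 + w = 1"
    using w char_two_add_eq_0_iff[OF two] by blast
  then have "(a * w) ^ 2 + a * (a * w) = a ^ 2"
    by (metis (no_types, lifting) distrib_left mult.assoc mult.right_neutral power2_eq_square
        power_mult_distrib)
  ultimately have "x ^ 2 + a * x = (a * w) ^ 2 + a * (a * w)"
    by simp
  from char_two_quadratic_roots[OF two this] show ?thesis
    by (auto simp: algebra_simps)
qed

text \<open>
  The Frobenius map of \<open>K\<close> permutes the two roots \<open>x\<close>, \<open>x + a\<close> of a quadratic over \<open>K\<close>;
  unless it fixes \<open>x\<close>, it sends \<open>x\<close> to \<open>x + a\<close>, which then is a power of \<open>x\<close>.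
\<close>
lemma quadratic_root_subfields:
  fixes a x d :: "'a::{field,finite}"
  assumes two: "(2::'a) = 0" and K: "is_subfield K" "card K = 2 ^ k" and L: "is_subfield L"
    and "a \<in> K" "d \<in> K" "x \<in> L" and eq: "x ^ 2 + a * x = d"
  shows "x \<in> K \<or> x + a \<in> L"
proof -
  define s where "s = (\<lambda>y::'a. y ^ (2 ^ k))"
  have fix_iff: "y \<in> K \<longleftrightarrow> s y = y" for y
    using subfield_mem_iff[OF K(1), of y] K by (simp add: s_def)
  have "x ^ m \<in> L" for m
    by (induction m) (use L \<open>x \<in> L\<close> in \<open>auto simp: is_subfield_def\<close>)
  then have "s x \<in> L"
    by (simp add: s_def)
  have "s (x ^ 2 + a * x) = s x ^ 2 + s a * s x"
    unfolding s_def char_two_frobenius[OF two]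
    by (simp add: power_mult_distrib mult.commute flip: power_mult)
  then have "s x ^ 2 + a * s x = x ^ 2 + a * x"
    using eq fix_iff[of a] fix_iff[of d] \<open>a \<in> K\<close> \<open>d \<in> K\<close> by simp
  from char_two_quadratic_roots[OF two this] show ?thesis
    using fix_iff[of x] \<open>s x \<in> L\<close> by metis
qed

text \<open>Rules out solutions of the second type in the delicate case. For \<open>x\<close> in
  \<open>L\<close>, clearing denominators gives a quadratic over \<open>K\<close>, so
  \<open>quadratic_root_subfields\<close> applies.\<close>

lemma inverse_derivative_shifted_subfields:
  fixes a x :: "'a::{field,finite}"
  assumes two: "(2::'a) = 0" and K: "is_subfield K" "card K = 2 ^ k" and L: "is_subfield L"
    and "a \<in> K" "a \<noteq> 0" and x: "inverse (x + a) + inverse x = inverse a + 1"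
    and "x \<in> K \<union> L"
  shows "x + a \<in> K \<union> L"
proof -
  note K' = K(1)[unfolded is_subfield_def]
  have "a / (inverse a + 1) \<in> K"
    using K' \<open>a \<in> K\<close> by (simp add: divide_inverse)
  moreover have "x ^ 2 + a * x = a / (inverse a + 1)"
    using inverse_derivative_generic(2)[OF two \<open>a \<noteq> 0\<close> _ x] by simp
  ultimately have "x \<in> K \<or> x + a \<in> L" if "x \<in> L"
    using quadratic_root_subfields[OF two K L \<open>a \<in> K\<close>] that by blast
  moreover have "x + a \<in> K" if "x \<in> K"
    using K' \<open>a \<in> K\<close> that by simp
  ultimately show ?thesis
    using \<open>x \<in> K \<union> L\<close> by auto
qed

section \<open>Permutation property and differential uniformity of \<open>f\<close>\<close>

theorem theorem3:
  fixes n k1 k2 :: nat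
    and K1 K2 S :: "'a::{field,finite} set"
    and f :: "'a \<Rightarrow> 'a"
  assumes "n > 1"
    and "CARD('a) = 2 ^ n"
    and "even k1" and "k1 dvd n"
    and "even k2" and "k2 dvd n"
    and "is_subfield K1" and "card K1 = 2 ^ k1"
    and "is_subfield K2" and "card K2 = 2 ^ k2"
    and "S = K1 \<union> K2"
    and "f = (\<lambda>x. inverse x + indicator S x)"
  shows "bij f \<and> differentially_uniform 4 f"
proof
  have two: "(2::'a) = 0"
    using char_two_of_card assms(2) by blast
  note K1 = \<open>is_subfield K1\<close>[unfolded is_subfield_def]
  note K2 = \<open>is_subfield K2\<close>[unfolded is_subfield_def]
  note self = char_two_add_self[OF two] and eq0 = char_two_add_eq_0_iff[OF two]
  have f_in: "f x = inverse x + 1" if "x \<in> S" for x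
    using that assms by simp
  have f_out: "f x = inverse x" if "x \<notin> S" for x
    using that assms by simp
  have inv_S: "inverse x \<in> S \<longleftrightarrow> x \<in> S" for x
    using K1 K2 assms(11) inverse_inverse_eq[of x] by (metis Un_iff)
  have succ_S: "x + 1 \<in> S" if "x \<in> S" for x
    using that K1 K2 assms(11) by blast
  have f_S: "f x \<in> S \<longleftrightarrow> x \<in> S" for x
    using f_in f_out inv_S succ_S by (cases "x \<in> S") auto
  have "inj f"
  proof (rule injI)
    fix x y assume eq: "f x = f y"
    then have "x \<in> S \<longleftrightarrow> y \<in> S"
      using f_S by metis
    with eq have "inverse x = inverse y"
      using f_in f_out by (cases "x \<in> S") auto
    then show "x = y"
      by simp
  qed
  then show "bij f"
    by (simp add: bij_betw_def finite_UNIV_inj_surj)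

  have "even n"
    using \<open>even k1\<close> \<open>k1 dvd n\<close> by (rule dvd_trans)
  then obtain m where "n = 2 * m"
    by (elim dvdE)
  \<comment> \<open>Writing 1 as \<open>1 ^ m\<close> exhibits a difference of powers, divisible by
    4 - 1 = 3; over \<open>int\<close> the subtraction is not truncated.\<close>
  then have "int CARD('a) - 1 = 4 ^ m - 1 ^ m"
    using assms(2) by (simp add: power_mult)
  then have "3 dvd int CARD('a) - 1"
    using power_diff_sumr2[of "4::int" m 1] by simp
  then have "3 dvd CARD('a) - 1"
    by presburger
  then obtain w :: 'a where w: "w ^ 2 + w + 1 = 0"
    by (rule exists_primitive_cube_root_of_unity)
  have "w \<noteq> 0"
    using w by auto
  moreover have "w + 1 \<noteq> 0"
    using w \<open>w \<noteq> 0\<close> by (auto simp: add.assoc)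
  ultimately have w0: "w \<noteq> 0" "w + 1 \<noteq> 0" "w \<noteq> 1"
    using eq0[of w 1] by blast+
  have wK: "w \<in> K1" "w \<in> K2"
    using cube_root_of_unity_mem_subfield[OF _ _ _ w] assms by blast+
  have w1K: "w + 1 \<in> K1" "w + 1 \<in> K2"
    using wK K1 K2 by blast+
  \<comment> \<open>Used with \<open>v\<close> equal to \<open>w\<close> and \<open>w + 1\<close>:
    the exceptional solutions \<open>a * w\<close> and \<open>a * (w + 1)\<close> lie in
    \<open>S\<close> exactly when \<open>a\<close> does.\<close>
  have mult_sub: "a * v \<in> K \<longleftrightarrow> a \<in> K" if "is_subfield K" "v \<in> K" "v \<noteq> 0" for a v :: 'a and K
  proof
    assume "a * v \<in> K"
    then have "a * v * inverse v \<in> K"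
      using that unfolding is_subfield_def by blast
    then show "a \<in> K"
      using that by (simp add: mult.assoc)
  qed (use that in \<open>auto simp: is_subfield_def\<close>)
  have wS: "a * w \<in> S \<longleftrightarrow> a \<in> S" "a * (w + 1) \<in> S \<longleftrightarrow> a \<in> S" for a
    using mult_sub assms(7,9,11) wK w1K w0 by auto

  have le4: "diff_count f a b \<le> 4" if a: "a \<noteq> 0" for a b
  proof -
    define T where "T = (\<lambda>c. {x. inverse (x + a) + inverse x = c})"
    \<comment> \<open>On \<open>P\<close> the two indicator values cancel; off \<open>P\<close> they
      add up to 1, which turns \<open>b\<close> into \<open>b + 1\<close>.\<close>
    define P where "P = {x. x \<in> S \<longleftrightarrow> x + a \<in> S}"
    have D: "{x. f (x + a) + f x = b} = T b \<inter> P \<union> (T (b + 1) - P)"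
    proof -
      have "f (x + a) + f x = b \<longleftrightarrow> (if x \<in> P then x \<in> T b else x \<in> T (b + 1))" for x
      proof -
        have succ: "u + 1 = b \<longleftrightarrow> u = b + 1" for u
          using self by (metis add.assoc add.right_neutral)
        have "u + 1 + (v + 1) = u + v" for u v :: 'a
          using self[of 1] by (metis add.assoc add.left_commute add.right_neutral)
        moreover have "u + 1 + v = b \<longleftrightarrow> u + v = b + 1" "u + (v + 1) = b \<longleftrightarrow> u + v = b + 1" for u v
          using succ[of "u + v"] by (simp_all only: add_ac)
        ultimately show ?thesis
          unfolding P_def T_def mem_Collect_eq
          by (cases "x \<in> S"; cases "x + a \<in> S") (simp_all only: f_in f_out if_True if_False simp_thms)
      qed
      then show ?thesis
        by (auto split: if_splits)
    qed
    have T2: "card (T c) \<le> 2" if "c \<noteq> inverse a" for c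
      using card_inverse_derivative_generic[OF two a that] by (simp add: T_def)
    have Ta: "T (inverse a) \<subseteq> {0, a, a * w, a * (w + 1)}"
      using inverse_derivative_special[OF two a w] by (auto simp: T_def)
    have "0 \<in> S"
      using K1 assms(11) by blast
    have P: "0 \<in> P \<longleftrightarrow> a \<in> S" "a \<in> P \<longleftrightarrow> a \<in> S" "a * w \<in> P" "a * (w + 1) \<in> P"
    proof -
      have "a * w + a = a * (w + 1)" "a * (w + 1) + a = a * w"
        using self by (simp_all add: algebra_simps)
      then show "0 \<in> P \<longleftrightarrow> a \<in> S" "a \<in> P \<longleftrightarrow> a \<in> S" "a * w \<in> P" "a * (w + 1) \<in> P"
        using \<open>0 \<in> S\<close> wS two by (auto simp: P_def)
    qed
    have sub2: "card A \<le> 2" if "A \<subseteq> {u, v}" for A :: "'a set" and u v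
      using card_mono[OF _ that] by (auto simp: card_insert_if split: if_splits)
    have b1: "b + 1 \<noteq> b"
      by simp
    have bound: "diff_count f a b \<le> card (T b \<inter> P) + card (T (b + 1) - P)"
      unfolding diff_count_def D by (rule card_Un_le)
    have cards: "card (T b \<inter> P) \<le> card (T b)" "card (T (b + 1) - P) \<le> card (T (b + 1))"
      by (auto intro: card_mono)
    \<comment> \<open>In the last three cases each of the two sets contributes at most 2: a generic
      value by \<open>T2\<close>, the value \<open>inverse a\<close> because \<open>P\<close>
      separates \<open>0\<close>, \<open>a\<close> from \<open>a * w\<close>,
      \<open>a * (w + 1)\<close> when needed.\<close>
    consider "b = inverse a" "a \<in> S" | "b = inverse a" "a \<notin> S" | "b + 1 = inverse a"
      | "b \<noteq> inverse a" "b + 1 \<noteq> inverse a"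
      by blast
    then show ?thesis
    proof cases
      case 1
      \<comment> \<open>The two instances cover \<open>a\<close> in \<open>K1\<close> and
        \<open>a\<close> in \<open>K2\<close>. As \<open>T (b + 1)\<close> is stable under adding
        \<open>a\<close>, the converse implication follows too, so \<open>T (b + 1)\<close> lies
        inside \<open>P\<close>.\<close>
      have *: "x + a \<in> S" if "x \<in> T (b + 1)" "x \<in> S" for x
        using inverse_derivative_shifted_subfields[OF two assms(7,8,9) _ a, of x]
          inverse_derivative_shifted_subfields[OF two assms(9,10,7) _ a, of x]
          that 1 assms(11) by (auto simp: T_def)
      have aa: "x + a + a = x" for x
        using self[of a] by (simp add: add.assoc)
      have "x + a \<in> T (b + 1)" if "x \<in> T (b + 1)" for x
        using that unfolding T_def mem_Collect_eq aa by (simp only: add.commute)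
      then have "card (T (b + 1) - P) = 0"
        using * aa by (fastforce simp: P_def)
      then have "diff_count f a b \<le> card (T b)"
        using bound cards(1) by linarith
      also have "\<dots> \<le> card {0, a, a * w, a * (w + 1)}"
        using Ta 1 by (intro card_mono) auto
      also have "\<dots> \<le> 4"
        by (simp add: card_insert_if)
      finally show ?thesis .
    next
      case 2
      then have "T b \<inter> P \<subseteq> {a * w, a * (w + 1)}"
        using Ta P by auto
      then show ?thesis
        using bound cards(2) T2[of "b + 1"] sub2[of "T b \<inter> P"] 2 b1 by fastforce
    next
      case 3
      then have "T (b + 1) - P \<subseteq> {0, a}"
        using Ta P by auto
      then show ?thesis
        using bound cards(1) T2[of b] sub2[of "T (b + 1) - P"] 3 b1 by fastforce
    next
      case 4
      then show ?thesis
        using bound cards T2[of b] T2[of "b + 1"] by linarith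
    qed
  qed

  \<comment> \<open>The bound is attained at \<open>a = b = 1\<close>: the four exceptional
    solutions all lie in \<open>S\<close>, so the indicators cancel.\<close>
  have "card {0, 1, w, w + 1} \<le> diff_count f 1 1"
    unfolding diff_count_def
  proof (intro card_mono subsetI)
    have S: "0 \<in> S" "1 \<in> S" "w \<in> S" "w + 1 \<in> S"
      using K1 wK w1K assms(11) by blast+
    have "w * (w + 1) = 1"
      using w eq0[of "w ^ 2 + w" 1] by (simp add: power2_eq_square algebra_simps)
    then have "inverse w = w + 1" "inverse (w + 1) = w"
      by (auto intro!: inverse_unique simp: mult.commute)
    then show "x \<in> {x. f (x + 1) + f x = 1}" if "x \<in> {0, 1, w, w + 1}" for x
      using that S two by (auto simp: f_in)
  qed simp
  moreover have "card {0, 1, w, w + 1} = 4"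
    using w0 by auto
  ultimately have eq4: "diff_count f 1 1 = 4"
    using le4[of 1 1] by simp
  have "Max {diff_count f a b | a b. a \<noteq> 0} = 4"
  proof (rule Max_eqI)
    show "finite {diff_count f a b | a b. a \<noteq> 0}"
      by (rule finite_subset[of _ "{..4}"]) (use le4 in auto)
    show "y \<le> 4" if "y \<in> {diff_count f a b | a b. a \<noteq> 0}" for y
      using that le4 by auto
    show "4 \<in> {diff_count f a b | a b. a \<noteq> 0}"
      using eq4 by (metis (mono_tags, lifting) mem_Collect_eq zero_neq_one)
  qed
  then show "differentially_uniform 4 f"
    by (simp add: differentially_uniform_def differential_uniformity_def)
qed

end
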